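(* Let $X$ be a compact metric space and $\mathsf{M}=(m_x)_{x\in X}$ a transition probability kernel on $X$ with the Feller property. If $\Phi=(\Phi_n)_{n\geqslant0}$ is a Markov chain with transition probability kernel $\mathsf{M}$, then with probability $1$, every accumulation point (in the weak-$*$ topology on Borel probability measures of $X$) of the sequence $$\frac1n\sum_{i=0}^{n-1}\delta_{\Phi_i}$$ is a stationary measure for $\Phi$.
   Context: A transition probability kernel is a family $(m_x)_{x\in X}$ of Borel probability measures on $X$ such that $x\mapsto m_x(A)$ is measurable for every Borel set $A$. It has the Feller property if $P\varphi(x)=\int_X\varphi\,dm_x$ defines a bounded continuous function for every bounded continuous $\varphi$. A stationary measure is a Borel probability measure $\nu$ with $\int_Xm_x(A)\,d\nu(x)=\nu(A)$ for every Borel set $A$. *)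

theory Defs
  imports "HOL-Probability.Probability"
begin

definition borel_prob_measures :: "'a::topological_space measure set" where
  "borel_prob_measures = {\<mu>. prob_space \<mu> \<and> sets \<mu> = sets borel}"

definition transition_kernel :: "('a::topological_space \<Rightarrow> 'a measure) \<Rightarrow> bool" where
  "transition_kernel m \<longleftrightarrow>
     (\<forall>x. m x \<in> borel_prob_measures) \<and>
     (\<forall>A \<in> sets borel. (\<lambda>x. measure (m x) A) \<in> borel_measurable borel)"

definition feller :: "('a::topological_space \<Rightarrow> 'a measure) \<Rightarrow> bool" where
  "feller m \<longleftrightarrow>
     (\<forall>\<phi> :: 'a \<Rightarrow> real. \<phi> \<in> bcontfun \<longrightarrow> (\<lambda>x. \<integral>y. \<phi> y \<partial>m x) \<in> bcontfun)"

definition stationary_measure ::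
    "('a::topological_space \<Rightarrow> 'a measure) \<Rightarrow> 'a measure \<Rightarrow> bool" where
  "stationary_measure m \<nu> \<longleftrightarrow>
     \<nu> \<in> borel_prob_measures \<and>
     (\<forall>A \<in> sets borel. (\<integral>x. measure (m x) A \<partial>\<nu>) = measure \<nu> A)"

definition past_algebra ::
    "'w measure \<Rightarrow> (nat \<Rightarrow> 'w \<Rightarrow> 'a::topological_space) \<Rightarrow> nat \<Rightarrow> 'w measure" where
  "past_algebra \<Omega> \<Phi> n =
     sigma (space \<Omega>) {\<Phi> i -` A \<inter> space \<Omega> | i A. i \<le> n \<and> A \<in> sets borel}"

text \<open>
  The initial distribution is arbitrary. The Markov property is required with respect to the
  natural filtration of the process: almost surely,
  \<open>P (\<Phi>\<^sub>n\<^sub>+\<^sub>1 \<in> A | \<Phi>\<^sub>0, \<dots>, \<Phi>\<^sub>n) = m (\<Phi>\<^sub>n) (A)\<close>.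
\<close>

definition markov_chain ::
    "'w measure \<Rightarrow> ('a::topological_space \<Rightarrow> 'a measure) \<Rightarrow> (nat \<Rightarrow> 'w \<Rightarrow> 'a) \<Rightarrow> bool" where
  "markov_chain \<Omega> m \<Phi> \<longleftrightarrow>
     prob_space \<Omega> \<and>
     (\<forall>n. \<Phi> n \<in> borel_measurable \<Omega>) \<and>
     (\<forall>n. \<forall>A \<in> sets borel. AE \<omega> in \<Omega>.
        real_cond_exp \<Omega> (past_algebra \<Omega> \<Phi> n)
          (indicator (\<Phi> (Suc n) -` A \<inter> space \<Omega>)) \<omega> = measure (m (\<Phi> n \<omega>)) A)"

text \<open>
  The measure \<open>(1/n) \<Sum>\<^sub>i\<^sub><\<^sub>n \<delta>\<^bsub>x i\<^esub>\<close>; the library has no addition of measures. For \<open>n = 0\<close> it is the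
  null measure.
\<close>

definition empirical_measure :: "(nat \<Rightarrow> 'a::topological_space) \<Rightarrow> nat \<Rightarrow> 'a measure" where
  "empirical_measure x n =
     measure_of UNIV (sets borel)
       (\<lambda>A. ennreal (1 / real n) * (\<Sum>i<n. emeasure (return borel (x i)) A))"

text \<open>
  The coarsest topology on the Borel probability measures for which integration against each
  (bounded) continuous function is continuous.
\<close>

definition weak_star_topology :: "'a::topological_space measure topology" where
  "weak_star_topology =
     topology_generated_by
       {{\<mu> \<in> borel_prob_measures. (\<integral>x. \<phi> x \<partial>\<mu>) \<in> U} | (\<phi> :: 'a \<Rightarrow> real) U.
          \<phi> \<in> bcontfun \<and> open U}"

definition accumulation_point :: "'b topology \<Rightarrow> (nat \<Rightarrow> 'b) \<Rightarrow> 'b \<Rightarrow> bool" where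
  "accumulation_point T s y \<longleftrightarrow>
     y \<in> topspace T \<and> (\<forall>U. openin T U \<and> y \<in> U \<longrightarrow> (\<exists>\<^sub>F n in sequentially. s n \<in> U))"

lemma topspace_weak_star_topology:
  "topspace weak_star_topology = (borel_prob_measures :: 'a::topological_space measure set)"
proof -
  have "(\<lambda>_::'a. 0::real) \<in> bcontfun"
    by (rule const_bcontfun)
  then have "borel_prob_measures \<in> {{\<mu> \<in> borel_prob_measures. (\<integral>x. \<phi> x \<partial>\<mu>) \<in> U} |
      (\<phi> :: 'a \<Rightarrow> real) U. \<phi> \<in> bcontfun \<and> open U}"
    by (intro CollectI exI[of _ "\<lambda>_::'a. 0::real"] exI[of _ "UNIV :: real set"]) simp
  then show ?thesis
    unfolding weak_star_topology_def topology_generated_by_topspace by blast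
qed

lemma sets_empirical_measure [simp]: "sets (empirical_measure x n) = sets borel"
  unfolding empirical_measure_def
  using sets.sets_measure_of_eq[of "borel :: 'a measure"] by simp

lemma space_empirical_measure [simp]: "space (empirical_measure x n) = UNIV"
  by (simp add: empirical_measure_def)

lemma emeasure_empirical_measure:
  assumes "A \<in> sets borel"
  shows "emeasure (empirical_measure x n) A =
    ennreal (1 / real n) * (\<Sum>i<n. indicator A (x i))"
proof -
  let ?f = "\<lambda>A. ennreal (1 / real n) * (\<Sum>i<n. emeasure (return borel (x i)) A)"
  have "emeasure (empirical_measure x n) A = ?f A"
  proof (rule emeasure_measure_of[OF empirical_measure_def])
    show "sets borel \<subseteq> Pow (UNIV :: 'a set)" by simp
    show "A \<in> sets (empirical_measure x n)" using assms by simp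
    show "positive (sets (empirical_measure x n)) ?f"
      by (simp add: positive_def)
    show "countably_additive (sets (empirical_measure x n)) ?f"
    proof (rule countably_additiveI)
      fix B :: "nat \<Rightarrow> 'a set"
      assume B: "range B \<subseteq> sets (empirical_measure x n)" "disjoint_family B"
      have "(\<Sum>j. ?f (B j)) =
          ennreal (1 / real n) * (\<Sum>i<n. \<Sum>j. emeasure (return borel (x i)) (B j))"
        by (simp add: ennreal_suminf_cmult suminf_sum)
      also have "\<dots> = ?f (\<Union>j. B j)"
        using B by (intro arg_cong2[where f = "(*)"] sum.cong refl suminf_emeasure) auto
      finally show "(\<Sum>j. ?f (B j)) = ?f (\<Union>j. B j)" .
    qed
  qed
  then show ?thesis using assms by simp
qed

lemma prob_space_empirical_measure:
  assumes "n > 0"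
  shows "prob_space (empirical_measure x n)"
proof (rule prob_spaceI)
  have "ennreal (1 / real n) * of_nat n = 1"
    using assms by (simp add: ennreal_of_nat_eq_real_of_nat ennreal_mult[symmetric])
  then show "emeasure (empirical_measure x n) (space (empirical_measure x n)) = 1"
    by (simp add: emeasure_empirical_measure)
qed

lemma subalgebra_past_algebra:
  assumes "\<And>i. \<Phi> i \<in> borel_measurable \<Omega>"
  shows "subalgebra \<Omega> (past_algebra \<Omega> \<Phi> n)"
proof -
  let ?G = "{\<Phi> i -` A \<inter> space \<Omega> | i A. i \<le> n \<and> A \<in> sets borel}"
  have G: "?G \<subseteq> sets \<Omega>"
    using assms by (auto intro: measurable_sets)
  have "?G \<subseteq> Pow (space \<Omega>)" by blast
  then have "sets (sigma (space \<Omega>) ?G) = sigma_sets (space \<Omega>) ?G"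
    by (rule sets_measure_of)
  with sets.sigma_sets_subset[OF G] show ?thesis
    unfolding subalgebra_def past_algebra_def by (simp add: space_measure_of_conv)
qed

end

theory Submission
  imports Defs "HOL-Library.Discrete_Functions"
begin

text \<open>
  Write \<open>P \<phi> x = \<integral>y. \<phi> y \<partial>m x\<close>. The variables \<open>\<phi> (\<Phi> (k + 1)) - P \<phi> (\<Phi> k)\<close> are bounded martingale
  differences, hence orthogonal in \<open>L\<^sup>2\<close>, and their averages tend to \<open>0\<close> almost surely: along the
  squares the second moments are summable, and boundedness fills the gaps. After telescoping, the
  integrals of \<open>\<phi> - P \<phi>\<close> against the empirical measures tend to \<open>0\<close>. By the Feller property
  \<open>\<phi> - P \<phi>\<close> is continuous, so every accumulation point \<open>\<nu>\<close> satisfies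
  \<open>\<integral>\<phi> \<partial>\<nu> = \<integral>P \<phi> \<partial>\<nu>\<close>. Countably many \<open>\<phi>\<close> suffice, so one null set does: compactness gives a
  countable family of open sets, closed under intersection, that generates the Borel sets, and the
  indicator of each member is the increasing limit of a sequence of continuous functions.
\<close>

section \<open>Averages of bounded orthogonal random variables\<close>

text \<open>Between consecutive squares there is little room: if \<open>k\<close> is the integer
  square root of \<open>n\<close>, then at most \<open>2 * k\<close> terms separate the sum up to
  \<open>k\<^sup>2\<close> from the sum up to \<open>n\<close>. Each is at most \<open>C\<close> in
  absolute value, so after division by at least \<open>k\<^sup>2\<close> they contribute at most
  \<open>2 * C / k\<close>.\<close>

lemma tendsto_mean_of_squares:
  fixes y :: "nat \<Rightarrow> real"
  assumes bound: "\<And>k. \<bar>y k\<bar> \<le> C"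
    and squares: "(\<lambda>k. (\<Sum>i<k\<^sup>2. y i) / real (k\<^sup>2)) \<longlonglongrightarrow> 0"
  shows "(\<lambda>n. (\<Sum>i<n. y i) / real n) \<longlonglongrightarrow> 0"
proof -
  define S where "S n = (\<Sum>i<n. y i)" for n
  let ?r = floor_sqrt
  have r: "filterlim ?r at_top sequentially"
  proof (unfold filterlim_at_top, intro allI)
    fix N
    show "eventually (\<lambda>n. N \<le> ?r n) sequentially"
      using eventually_ge_at_top[of "N\<^sup>2"] by eventually_elim (rule le_floor_sqrtI)
  qed
  have C: "0 \<le> C"
    using bound[of 0] by linarith
  have "(\<lambda>k. \<bar>S (k\<^sup>2) / real (k\<^sup>2)\<bar>) \<longlonglongrightarrow> 0"
    using squares unfolding S_def by (rule tendsto_rabs_zero)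
  moreover have "(\<lambda>k. 2 * C / real k) \<longlonglongrightarrow> 0"
    by (rule lim_const_over_n)
  ultimately have "(\<lambda>k. \<bar>S (k\<^sup>2) / real (k\<^sup>2)\<bar> + 2 * C / real k) \<longlonglongrightarrow> 0 + 0"
    by (rule tendsto_add)
  then have lim: "(\<lambda>n. \<bar>S ((?r n)\<^sup>2) / real ((?r n)\<^sup>2)\<bar> + 2 * C / real (?r n)) \<longlonglongrightarrow> 0"
    using filterlim_compose[OF _ r] by fastforce
  have "\<forall>\<^sub>F n in sequentially.
      norm (S n / real n) \<le> \<bar>S ((?r n)\<^sup>2) / real ((?r n)\<^sup>2)\<bar> + 2 * C / real (?r n)"
    using eventually_gt_at_top[of 0]
  proof eventually_elim
    fix n :: nat
    assume n: "0 < n"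
    define k where "k = ?r n"
    have k: "0 < k" "k\<^sup>2 \<le> n" "n \<le> k\<^sup>2 + 2 * k"
      using n floor_sqrt_power2_le[of n] Suc_floor_sqrt_power2_gt[of n]
      unfolding k_def by (simp_all add: power2_eq_square del: floor_sqrt_power2_le)
    have "S n - S (k\<^sup>2) = (\<Sum>i=k\<^sup>2..<n. y i)"
      using k(2) unfolding S_def lessThan_atLeast0 by (simp add: sum_diff_nat_ivl)
    also have "\<bar>\<dots>\<bar> \<le> (\<Sum>i=k\<^sup>2..<n. C)"
      using bound by (intro order_trans[OF sum_abs] sum_mono)
    also have "\<dots> = real (n - k\<^sup>2) * C"
      by simp
    also have "\<dots> \<le> real (2 * k) * C"
      using k(3) C by (intro mult_right_mono) auto
    finally have "\<bar>S n - S (k\<^sup>2)\<bar> \<le> 2 * C * real k"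
      by (simp add: mult_ac)
    then have "\<bar>S n\<bar> \<le> \<bar>S (k\<^sup>2)\<bar> + 2 * C * real k"
      by linarith
    moreover have "real (k\<^sup>2) \<le> real n"
      using k(2) of_nat_le_iff by blast
    \<comment> \<open>The denominator is lowered from \<open>n\<close> to \<open>k\<^sup>2\<close>,
      so that only the average along the squares and the gap term remain.\<close>
    ultimately have "\<bar>S n\<bar> / real n \<le> (\<bar>S (k\<^sup>2)\<bar> + 2 * C * real k) / real (k\<^sup>2)"
      using C k(1) by (intro frac_le) auto
    also have "\<dots> = \<bar>S (k\<^sup>2)\<bar> / real (k\<^sup>2) + 2 * C / real k"
      using k(1) by (simp add: field_simps power2_eq_square)
    finally show "norm (S n / real n) \<le>
        \<bar>S ((?r n)\<^sup>2) / real ((?r n)\<^sup>2)\<bar> + 2 * C / real (?r n)"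
      by (simp add: k_def)
  qed
  from Lim_null_comparison[OF this lim] show ?thesis
    unfolding S_def .
qed

text \<open>When the square of the sum is expanded, orthogonality removes the cross terms, so the
  second moment grows linearly in \<open>n\<close> rather than quadratically.\<close>

lemma (in prob_space) expectation_square_sum_orthogonal:
  fixes Y :: "nat \<Rightarrow> 'a \<Rightarrow> real"
  assumes [measurable]: "\<And>k. Y k \<in> borel_measurable M"
    and bound: "\<And>k \<omega>. \<bar>Y k \<omega>\<bar> \<le> C"
    and orth: "\<And>j k. j < k \<Longrightarrow> expectation (\<lambda>\<omega>. Y j \<omega> * Y k \<omega>) = 0"
  shows "integrable M (\<lambda>\<omega>. (\<Sum>k<n. Y k \<omega>)\<^sup>2)"
    and "expectation (\<lambda>\<omega>. (\<Sum>k<n. Y k \<omega>)\<^sup>2) \<le> real n * C\<^sup>2"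
proof -
  have C: "0 \<le> C"
    using bound[of 0 undefined] by linarith
  have YY: "integrable M (\<lambda>\<omega>. Y j \<omega> * Y k \<omega>)" for j k
    by (rule integrable_const_bound[where B = "C * C"])
      (auto simp: abs_mult intro!: mult_mono bound C)
  have SY: "integrable M (\<lambda>\<omega>. (\<Sum>k<n. Y k \<omega>) * Y j \<omega>)" for n j
    unfolding sum_distrib_right by (intro Bochner_Integration.integrable_sum YY)
  show int: "integrable M (\<lambda>\<omega>. (\<Sum>k<n. Y k \<omega>)\<^sup>2)" for n
    unfolding power2_eq_square sum_distrib_left by (intro Bochner_Integration.integrable_sum SY)
  show "expectation (\<lambda>\<omega>. (\<Sum>k<n. Y k \<omega>)\<^sup>2) \<le> real n * C\<^sup>2"
  proof (induction n)
    case (Suc n)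
    have "expectation (\<lambda>\<omega>. (\<Sum>k<n. Y k \<omega>) * Y n \<omega>) = 0"
      unfolding sum_distrib_right by (simp add: Bochner_Integration.integral_sum YY orth)
    moreover have "expectation (\<lambda>\<omega>. (Y n \<omega>)\<^sup>2) \<le> C\<^sup>2"
    proof -
      have "(Y n \<omega>)\<^sup>2 \<le> C\<^sup>2" for \<omega>
        using bound[of n \<omega>] C by (simp add: abs_le_square_iff[symmetric])
      then have "expectation (\<lambda>\<omega>. (Y n \<omega>)\<^sup>2) \<le> expectation (\<lambda>_. C\<^sup>2)"
        using YY[of n n] by (intro integral_mono) (auto simp: power2_eq_square)
      then show ?thesis
        by (simp add: prob_space)
    qed
    moreover have "expectation (\<lambda>\<omega>. (\<Sum>k<Suc n. Y k \<omega>)\<^sup>2) =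
        expectation (\<lambda>\<omega>. (\<Sum>k<n. Y k \<omega>)\<^sup>2 + (2 * ((\<Sum>k<n. Y k \<omega>) * Y n \<omega>) + (Y n \<omega>)\<^sup>2))"
      by (intro arg_cong[where f = expectation]) (simp add: fun_eq_iff power2_sum)
    ultimately show ?case
      using Suc int[of n] SY[of n n] YY[of n n]
      by (simp add: power2_eq_square[of "Y n _"] algebra_simps)
  qed simp
qed

text \<open>Linear growth of the second moments bounds the expected squared average at time
  \<open>k\<^sup>2\<close> by a multiple of \<open>1 / k\<^sup>2\<close>, which is summable. The
  series of squared averages is therefore almost surely finite, and its terms tend to 0; the times
  between squares are then filled in pathwise.\<close>

lemma (in prob_space) strong_law_orthogonal_bounded:
  fixes Y :: "nat \<Rightarrow> 'a \<Rightarrow> real"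
  assumes [measurable]: "\<And>k. Y k \<in> borel_measurable M"
    and bound: "\<And>k \<omega>. \<bar>Y k \<omega>\<bar> \<le> C"
    and orth: "\<And>j k. j < k \<Longrightarrow> expectation (\<lambda>\<omega>. Y j \<omega> * Y k \<omega>) = 0"
  shows "AE \<omega> in M. (\<lambda>n. (\<Sum>k<n. Y k \<omega>) / real n) \<longlonglongrightarrow> 0"
proof -
  note S = expectation_square_sum_orthogonal[of Y, OF assms]
  define Z where "Z k \<omega> = ((\<Sum>i<k\<^sup>2. Y i \<omega>) / real (k\<^sup>2))\<^sup>2" for k \<omega>
  have [measurable]: "Z k \<in> borel_measurable M" for k
    unfolding Z_def by measurable
  \<comment> \<open>This includes \<open>k = 0\<close>: division by zero yields 0, so both sides
    vanish there.\<close>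
  have le: "(\<integral>\<^sup>+\<omega>. ennreal (Z k \<omega>) \<partial>M) \<le> ennreal (C\<^sup>2 * (1 / (real k)\<^sup>2))" for k
  proof -
    have "integrable M (Z k)" and *: "expectation (Z k) =
        expectation (\<lambda>\<omega>. (\<Sum>i<k\<^sup>2. Y i \<omega>)\<^sup>2) / (real (k\<^sup>2))\<^sup>2"
      unfolding Z_def power_divide using S(1) by auto
    then have "(\<integral>\<^sup>+\<omega>. ennreal (Z k \<omega>) \<partial>M) = ennreal (expectation (Z k))"
      by (intro nn_integral_eq_integral) (simp_all add: Z_def[abs_def])
    also have "expectation (Z k) \<le> (real (k\<^sup>2) * C\<^sup>2) / (real (k\<^sup>2))\<^sup>2"
      unfolding * by (intro divide_right_mono S(2)) auto
    also have "\<dots> = C\<^sup>2 * (1 / (real k)\<^sup>2)"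
      by (simp add: power2_eq_square)
    finally show ?thesis
      by (simp add: ennreal_leI)
  qed
  have sm: "summable (\<lambda>k. C\<^sup>2 * (1 / (real k)\<^sup>2))"
    using inverse_power_summable[of 2, where 'a = real]
    by (intro summable_mult) (simp add: field_simps)
  have "(\<integral>\<^sup>+\<omega>. (\<Sum>k. ennreal (Z k \<omega>)) \<partial>M) = (\<Sum>k. \<integral>\<^sup>+\<omega>. ennreal (Z k \<omega>) \<partial>M)"
    by (intro nn_integral_suminf) measurable
  also have "\<dots> \<le> (\<Sum>k. ennreal (C\<^sup>2 * (1 / (real k)\<^sup>2)))"
    by (intro suminf_le le) auto
  also have "\<dots> < \<infinity>"
    using sm by (subst suminf_ennreal2) auto
  finally have "AE \<omega> in M. (\<Sum>k. ennreal (Z k \<omega>)) \<noteq> \<infinity>"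
    by (intro nn_integral_PInf_AE) auto
  then show ?thesis
  proof eventually_elim
    fix \<omega>
    assume "(\<Sum>k. ennreal (Z k \<omega>)) \<noteq> \<infinity>"
    then have "summable (\<lambda>k. Z k \<omega>)"
      by (intro summable_suminf_not_top) (auto simp: Z_def)
    then have "(\<lambda>k. sqrt (Z k \<omega>)) \<longlonglongrightarrow> 0"
      using summable_LIMSEQ_zero tendsto_real_sqrt by fastforce
    then have "(\<lambda>k. (\<Sum>i<k\<^sup>2. Y i \<omega>) / real (k\<^sup>2)) \<longlonglongrightarrow> 0"
      by (simp only: Z_def real_sqrt_abs tendsto_rabs_zero_iff)
    with bound show "(\<lambda>n. (\<Sum>k<n. Y k \<omega>) / real n) \<longlonglongrightarrow> 0"
      by (rule tendsto_mean_of_squares)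
  qed
qed

section \<open>Transition kernels acting on measures and functions\<close>

text \<open>Recasts setwise measurability of the kernel as measurability into the Giry space, the
  form in which \<open>\<bind>\<close> and its integral formulas apply.\<close>

lemma transition_kernel_measurable:
  assumes "transition_kernel m"
  shows "m \<in> borel \<rightarrow>\<^sub>M subprob_algebra borel"
proof (rule measurable_subprob_algebra)
  fix x
  have p: "prob_space (m x)" "sets (m x) = sets borel" for x
    using assms by (auto simp: transition_kernel_def borel_prob_measures_def)
  then show "subprob_space (m x)" "sets (m x) = sets borel"
    by (auto intro: prob_space_imp_subprob_space)
  fix A :: "'a set"
  assume "A \<in> sets borel"
  then have "(\<lambda>x. ennreal (measure (m x) A)) \<in> borel_measurable borel"
    using assms by (auto simp: transition_kernel_def)
  then show "(\<lambda>x. emeasure (m x) A) \<in> borel_measurable borel"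
    using p by (simp add: finite_measure.emeasure_eq_measure prob_space.finite_measure)
qed

lemma transition_kernel_prob_space:
  assumes "transition_kernel m"
  shows "prob_space (m x)" and "sets (m x) = sets borel"
  using assms by (auto simp: transition_kernel_def borel_prob_measures_def)

text \<open>\<open>N\<close> ranges over finite measures and not just probability measures, because
  the formula is also applied to the law of the chain restricted to an event.\<close>

lemma integral_bind_transition_kernel:
  fixes \<phi> :: "'a::topological_space \<Rightarrow> real"
  assumes m: "transition_kernel m"
    and N: "finite_measure N" "sets N = sets borel"
    and \<phi>: "\<phi> \<in> borel_measurable borel" "bounded (range \<phi>)"
  shows "(\<integral>x. \<phi> x \<partial>(N \<bind> m)) = (\<integral>x. \<integral>y. \<phi> y \<partial>m x \<partial>N)"
proof -
  obtain B where "\<And>x. \<bar>\<phi> x\<bar> \<le> B"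
    using \<phi>(2) by (auto simp: bounded_iff)
  moreover have "m \<in> N \<rightarrow>\<^sub>M subprob_algebra borel"
    using transition_kernel_measurable[OF m] N(2) by (simp cong: measurable_cong_sets)
  moreover have "emeasure (m x) (space (m x)) \<le> ennreal 1" for x
    using prob_space.emeasure_space_1[OF transition_kernel_prob_space(1)[OF m]] by simp
  ultimately show ?thesis
    using \<phi>(1) N(1) by (intro integral_bind[where K = borel and B = B and B' = 1]) auto
qed

lemma emeasure_bind_transition_kernel:
  assumes m: "transition_kernel m" and N: "sets N = sets borel" and A: "A \<in> sets borel"
  shows "emeasure (N \<bind> m) A = (\<integral>\<^sup>+x. ennreal (measure (m x) A) \<partial>N)"
proof -
  have "space N = UNIV"
    using sets_eq_imp_space_eq[OF N] by simp
  moreover have "m \<in> N \<rightarrow>\<^sub>M subprob_algebra borel"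
    using transition_kernel_measurable[OF m] N by (simp cong: measurable_cong_sets)
  ultimately have "emeasure (N \<bind> m) A = (\<integral>\<^sup>+x. emeasure (m x) A \<partial>N)"
    using A by (intro emeasure_bind) auto
  then show ?thesis
    using transition_kernel_prob_space(1)[OF m]
    by (simp add: finite_measure.emeasure_eq_measure prob_space.finite_measure)
qed

lemma transition_kernel_integral:
  fixes \<phi> :: "'a::topological_space \<Rightarrow> real"
  assumes m: "transition_kernel m" and \<phi>: "\<phi> \<in> borel_measurable borel" "\<And>x. \<bar>\<phi> x\<bar> \<le> B"
  shows "(\<lambda>x. \<integral>y. \<phi> y \<partial>m x) \<in> borel_measurable borel" and "\<bar>\<integral>y. \<phi> y \<partial>m x\<bar> \<le> B"
proof -
  show "(\<lambda>x. \<integral>y. \<phi> y \<partial>m x) \<in> borel_measurable borel"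
    by (rule measurable_compose[OF transition_kernel_measurable[OF m]])
      (rule integral_measurable_subprob_algebra[OF \<phi>(1)])
  interpret prob_space "m x"
    by (rule transition_kernel_prob_space[OF m])
  have "\<phi> \<in> borel_measurable (m x)"
    using \<phi>(1) transition_kernel_prob_space(2)[OF m] by (simp cong: measurable_cong_sets)
  then have i: "integrable (m x) \<phi>"
    using \<phi>(2) by (intro integrable_const_bound[where B = B]) auto
  have "\<bar>\<integral>y. \<phi> y \<partial>m x\<bar> \<le> (\<integral>y. \<bar>\<phi> y\<bar> \<partial>m x)"
    by (rule integral_abs_bound)
  also have "\<dots> \<le> B"
    using i \<phi>(2) by (intro integral_le_const) auto
  finally show "\<bar>\<integral>y. \<phi> y \<partial>m x\<bar> \<le> B" .
qed

section \<open>Conditional expectation and averages along the chain\<close>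

lemma measurable_past_algebra:
  assumes "i \<le> n"
  shows "\<Phi> i \<in> past_algebra \<Omega> \<Phi> n \<rightarrow>\<^sub>M borel"
proof (rule measurableI)
  let ?G = "{\<Phi> i -` A \<inter> space \<Omega> | i A. i \<le> n \<and> A \<in> sets borel}"
  fix A :: "'b set"
  assume "A \<in> sets borel"
  then have "\<Phi> i -` A \<inter> space \<Omega> \<in> ?G"
    using assms by blast
  moreover have "?G \<subseteq> Pow (space \<Omega>)"
    by blast
  ultimately show "\<Phi> i -` A \<inter> space (past_algebra \<Omega> \<Phi> n) \<in> sets (past_algebra \<Omega> \<Phi> n)"
    by (simp add: past_algebra_def space_measure_of_conv)
qed simp

text \<open>The Markov property is given for indicators only. Instead of approximating
  \<open>\<phi>\<close> by simple functions, the proof fixes an event \<open>S\<close> of the past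
  and reads the property as an identity of measures: the law of the next state on \<open>S\<close>
  is the law of the present state on \<open>S\<close> pushed through the kernel. Integrating
  \<open>\<phi>\<close> against both sides gives the defining property of the conditional
  expectation.\<close>

lemma markov_chain_cond_exp:
  fixes \<phi> :: "'a::topological_space \<Rightarrow> real"
  assumes mc: "markov_chain \<Omega> m \<Phi>" and m: "transition_kernel m"
    and \<phi>[measurable]: "\<phi> \<in> borel_measurable borel" and bdd: "\<And>x. \<bar>\<phi> x\<bar> \<le> B"
  shows "AE \<omega> in \<Omega>. real_cond_exp \<Omega> (past_algebra \<Omega> \<Phi> n) (\<lambda>\<omega>. \<phi> (\<Phi> (Suc n) \<omega>)) \<omega> =
    (\<integral>y. \<phi> y \<partial>m (\<Phi> n \<omega>))"
proof -
  let ?F = "past_algebra \<Omega> \<Phi> n"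
  interpret prob_space \<Omega>
    using mc by (simp add: markov_chain_def)
  have \<Phi>[measurable]: "\<Phi> i \<in> borel_measurable \<Omega>" for i
    using mc by (simp add: markov_chain_def)
  interpret finite_measure_subalgebra \<Omega> ?F
    by unfold_locales (rule subalgebra_past_algebra[OF \<Phi>])
  have m_meas[measurable]: "(\<lambda>x. measure (m x) A) \<in> borel_measurable borel"
    if "A \<in> sets borel" for A
    using m that by (simp add: transition_kernel_def)
  note P[measurable] = transition_kernel_integral(1)[OF m \<phi> bdd]
  have past[measurable]: "\<Phi> n \<in> ?F \<rightarrow>\<^sub>M borel"
    by (simp add: measurable_past_algebra)
  show ?thesis
  proof (rule real_cond_exp_charact)
    show "integrable \<Omega> (\<lambda>\<omega>. \<phi> (\<Phi> (Suc n) \<omega>))"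
      using bdd by (intro integrable_const_bound[where B = B]) auto
    show "integrable \<Omega> (\<lambda>\<omega>. \<integral>y. \<phi> y \<partial>m (\<Phi> n \<omega>))"
      using transition_kernel_integral(2)[OF m \<phi> bdd]
      by (intro integrable_const_bound[where B = B]) auto
    show "(\<lambda>\<omega>. \<integral>y. \<phi> y \<partial>m (\<Phi> n \<omega>)) \<in> borel_measurable ?F"
      by measurable
  next
    fix S
    assume S: "S \<in> sets ?F"
    then have S'[measurable]: "S \<in> sets \<Omega>"
      using subalg by (auto simp: subalgebra_def)
    \<comment> \<open>Restricting the measure to \<open>S\<close> turns set integrals over
      \<open>S\<close> into ordinary integrals; \<open>D k\<close> below is then the law of
      \<open>\<Phi> k\<close> on \<open>S\<close>, of total mass equal to the probability of
      \<open>S\<close>.\<close>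
    define N where "N = density \<Omega> (indicator S)"
    have N: "finite_measure N"
      unfolding N_def by (intro finite_measureI) (simp add: emeasure_density)
    have [measurable_cong, simp]: "sets N = sets \<Omega>"
      by (simp add: N_def)
    have space_N: "space N = space \<Omega>"
      by (simp add: N_def)
    define D where "D k = distr N borel (\<Phi> k)" for k
    have D: "finite_measure (D k)" "sets (D k) = sets borel" for k
      unfolding D_def using N by (auto intro!: finite_measure.finite_measure_distr)
    have D_integral: "(\<integral>x. f x \<partial>D k) = (\<integral>\<omega>\<in>S. f (\<Phi> k \<omega>) \<partial>\<Omega>)"
      if [measurable]: "f \<in> borel_measurable borel" for f :: "'a \<Rightarrow> real" and k
    proof -
      have "(\<integral>x. f x \<partial>D k) = (\<integral>\<omega>. f (\<Phi> k \<omega>) \<partial>N)"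
        unfolding D_def by (intro integral_distr) auto
      also have "N = density \<Omega> (\<lambda>\<omega>. ennreal (indicator S \<omega>))"
        by (simp add: N_def ennreal_indicator)
      also have "(\<integral>\<omega>. f (\<Phi> k \<omega>) \<partial>\<dots>) = (\<integral>\<omega>. indicator S \<omega> *\<^sub>R f (\<Phi> k \<omega>) \<partial>\<Omega>)"
        by (intro integral_density) auto
      finally show ?thesis
        by (simp add: set_lebesgue_integral_def)
    qed
    have "D (Suc n) = D n \<bind> m"
    proof (rule measure_eqI)
      show "sets (D (Suc n)) = sets (D n \<bind> m)"
        using D(2) transition_kernel_prob_space(2)[OF m] sets_eq_imp_space_eq[OF D(2)[of n]]
        by (subst sets_bind[where N = borel]) auto
      fix A
      assume "A \<in> sets (D (Suc n))"
      then have A[measurable]: "A \<in> sets borel"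
        using D by simp
      let ?I = "indicator (\<Phi> (Suc n) -` A \<inter> space \<Omega>) :: 'b \<Rightarrow> real"
      have ce: "AE \<omega> in \<Omega>. real_cond_exp \<Omega> ?F ?I \<omega> = measure (m (\<Phi> n \<omega>)) A"
        using mc A by (simp add: markov_chain_def)
      have "measure (D (Suc n)) A = (\<integral>x. indicator A x \<partial>D (Suc n))"
        using D by simp
      also have "\<dots> = (\<integral>\<omega>\<in>S. indicator A (\<Phi> (Suc n) \<omega>) \<partial>\<Omega>)"
        by (intro D_integral) simp
      also have "\<dots> = (\<integral>\<omega>\<in>S. ?I \<omega> \<partial>\<Omega>)"
        by (intro set_lebesgue_integral_cong) (auto simp: indicator_def intro: subsetD[OF sets.sets_into_space[OF S']])
      also have "\<dots> = (\<integral>\<omega>\<in>S. real_cond_exp \<Omega> ?F ?I \<omega> \<partial>\<Omega>)"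
        by (intro real_cond_exp_intA S integrable_real_indicator) (auto simp: less_top[symmetric])
      also have "\<dots> = (\<integral>\<omega>\<in>S. measure (m (\<Phi> n \<omega>)) A \<partial>\<Omega>)"
        using ce by (intro set_lebesgue_integral_cong_AE) (auto elim: eventually_mono)
      also have "\<dots> = (\<integral>x. measure (m x) A \<partial>D n)"
        by (rule D_integral[symmetric]) simp
      finally have *: "measure (D (Suc n)) A = (\<integral>x. measure (m x) A \<partial>D n)" .
      interpret Dn: finite_measure "D n"
        by (rule D)
      have "integrable (D n) (\<lambda>x. measure (m x) A)"
        using prob_space.prob_le_1[OF transition_kernel_prob_space(1)[OF m]] m_meas[OF A] D(2)
        by (intro Dn.integrable_const_bound[where B = 1]) (auto cong: measurable_cong_sets)
      then have "(\<integral>\<^sup>+x. ennreal (measure (m x) A) \<partial>D n) = ennreal (measure (D (Suc n)) A)"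
        unfolding * by (intro nn_integral_eq_integral) auto
      then show "emeasure (D (Suc n)) A = emeasure (D n \<bind> m) A"
        using D finite_measure.emeasure_eq_measure[OF D(1)]
        by (simp add: emeasure_bind_transition_kernel[OF m] A)
    qed
    moreover have "bounded (range \<phi>)"
      using bdd by (auto simp: bounded_iff)
    ultimately have "(\<integral>x. \<phi> x \<partial>D (Suc n)) = (\<integral>x. \<integral>y. \<phi> y \<partial>m x \<partial>D n)"
      using integral_bind_transition_kernel[OF m D \<phi>] by simp
    then show "(\<integral>\<omega>\<in>S. \<phi> (\<Phi> (Suc n) \<omega>) \<partial>\<Omega>) = (\<integral>\<omega>\<in>S. \<integral>y. \<phi> y \<partial>m (\<Phi> n \<omega>) \<partial>\<Omega>)"
      by (simp add: D_integral)
  qed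
qed

text \<open>The strong law is applied to the one-step prediction errors \<open>Y k\<close>; shifting
  the index of \<open>\<phi> (\<Phi> (Suc k) \<omega>)\<close> back by one then costs only a
  telescoping remainder.\<close>

lemma markov_chain_mean_defect_tendsto_0:
  fixes \<phi> :: "'a::topological_space \<Rightarrow> real"
  assumes mc: "markov_chain \<Omega> m \<Phi>" and m: "transition_kernel m"
    and \<phi>[measurable]: "\<phi> \<in> borel_measurable borel" and bdd: "\<And>x. \<bar>\<phi> x\<bar> \<le> B"
  shows "AE \<omega> in \<Omega>.
    (\<lambda>n. (\<Sum>k<n. \<phi> (\<Phi> k \<omega>) - (\<integral>y. \<phi> y \<partial>m (\<Phi> k \<omega>))) / real n) \<longlonglongrightarrow> 0"
proof -
  interpret prob_space \<Omega>
    using mc by (simp add: markov_chain_def)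
  have \<Phi>[measurable]: "\<Phi> i \<in> borel_measurable \<Omega>" for i
    using mc by (simp add: markov_chain_def)
  define P where "P x = (\<integral>y. \<phi> y \<partial>m x)" for x
  have [measurable]: "P \<in> borel_measurable borel" and P: "\<bar>P x\<bar> \<le> B" for x
    unfolding P_def using transition_kernel_integral[OF m \<phi> bdd] by auto
  define Y where "Y k \<omega> = \<phi> (\<Phi> (Suc k) \<omega>) - P (\<Phi> k \<omega>)" for k \<omega>
  have [measurable]: "Y k \<in> borel_measurable \<Omega>" for k
    unfolding Y_def by measurable
  have Y: "\<bar>Y k \<omega>\<bar> \<le> 2 * B" for k \<omega>
    unfolding Y_def using bdd[of "\<Phi> (Suc k) \<omega>"] P[of "\<Phi> k \<omega>"] by linarith
  \<comment> \<open>As \<open>Suc j \<le> k\<close>, the factor \<open>Y j\<close> is known at time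
    \<open>k\<close> and can be pulled through the conditional expectation, which replaces
    \<open>\<phi> (\<Phi> (Suc k) \<omega>)\<close> by \<open>P (\<Phi> k \<omega>)\<close>; the two
    halves of the product cancel.\<close>
  have orth: "expectation (\<lambda>\<omega>. Y j \<omega> * Y k \<omega>) = 0" if "j < k" for j k
  proof -
    let ?F = "past_algebra \<Omega> \<Phi> k"
    interpret finite_measure_subalgebra \<Omega> ?F
      by unfold_locales (rule subalgebra_past_algebra[OF \<Phi>])
    have [measurable]: "\<Phi> (Suc j) \<in> ?F \<rightarrow>\<^sub>M borel" "\<Phi> j \<in> ?F \<rightarrow>\<^sub>M borel"
      using that by (auto intro: measurable_past_algebra)
    have Yj: "Y j \<in> borel_measurable ?F"
      unfolding Y_def by measurable
    have B: "0 \<le> B"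
      using bdd[of undefined] by linarith
    have i1: "integrable \<Omega> (\<lambda>\<omega>. Y j \<omega> * \<phi> (\<Phi> (Suc k) \<omega>))"
      using B by (intro integrable_const_bound[where B = "2 * B * B"])
        (auto simp: abs_mult intro!: mult_mono Y bdd)
    have i2: "integrable \<Omega> (\<lambda>\<omega>. Y j \<omega> * P (\<Phi> k \<omega>))"
      using B by (intro integrable_const_bound[where B = "2 * B * B"])
        (auto simp: abs_mult intro!: mult_mono Y P)
    have "expectation (\<lambda>\<omega>. Y j \<omega> * P (\<Phi> k \<omega>)) =
        expectation (\<lambda>\<omega>. Y j \<omega> * real_cond_exp \<Omega> ?F (\<lambda>\<omega>. \<phi> (\<Phi> (Suc k) \<omega>)) \<omega>)"
      using markov_chain_cond_exp[OF mc m \<phi> bdd, of k]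
      by (intro integral_cong_AE) (auto simp: P_def[symmetric])
    also have "\<dots> = expectation (\<lambda>\<omega>. Y j \<omega> * \<phi> (\<Phi> (Suc k) \<omega>))"
      by (intro real_cond_exp_intg i1 Yj) simp
    finally show ?thesis
      using i1 i2 by (simp add: Y_def[of k] right_diff_distrib)
  qed
  have "AE \<omega> in \<Omega>. (\<lambda>n. (\<Sum>k<n. Y k \<omega>) / real n) \<longlonglongrightarrow> 0"
    by (rule strong_law_orthogonal_bounded[OF _ Y orth]) auto
  then show ?thesis
  proof eventually_elim
    fix \<omega>
    assume "(\<lambda>n. (\<Sum>k<n. Y k \<omega>) / real n) \<longlonglongrightarrow> 0"
    \<comment> \<open>The boundary term left by telescoping; it is bounded before division by
      \<open>n\<close>.\<close>
    moreover have "(\<lambda>n. (\<phi> (\<Phi> 0 \<omega>) - \<phi> (\<Phi> n \<omega>)) / real n) \<longlonglongrightarrow> 0"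
    proof (rule Lim_null_comparison)
      have "norm ((\<phi> (\<Phi> 0 \<omega>) - \<phi> (\<Phi> n \<omega>)) / real n) \<le> 2 * B / real n" for n
        using bdd[of "\<Phi> 0 \<omega>"] bdd[of "\<Phi> n \<omega>"] by (auto intro!: divide_right_mono)
      then show "\<forall>\<^sub>F n in sequentially.
          norm ((\<phi> (\<Phi> 0 \<omega>) - \<phi> (\<Phi> n \<omega>)) / real n) \<le> 2 * B / real n"
        by simp
      show "(\<lambda>n. 2 * B / real n) \<longlonglongrightarrow> 0"
        by (rule lim_const_over_n)
    qed
    ultimately have "(\<lambda>n. (\<Sum>k<n. Y k \<omega>) / real n + (\<phi> (\<Phi> 0 \<omega>) - \<phi> (\<Phi> n \<omega>)) / real n)
        \<longlonglongrightarrow> 0 + 0"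
      by (rule tendsto_add)
    moreover have "(\<Sum>k<n. \<phi> (\<Phi> k \<omega>) - P (\<Phi> k \<omega>)) =
        (\<Sum>k<n. Y k \<omega>) + (\<phi> (\<Phi> 0 \<omega>) - \<phi> (\<Phi> n \<omega>))" for n
      by (induction n) (auto simp: Y_def)
    ultimately show "(\<lambda>n. (\<Sum>k<n. \<phi> (\<Phi> k \<omega>) - (\<integral>y. \<phi> y \<partial>m (\<Phi> k \<omega>))) / real n) \<longlonglongrightarrow> 0"
      by (simp add: P_def add_divide_distrib)
  qed
qed

section \<open>Empirical measures and weak-star accumulation points\<close>

text \<open>The empirical measure is the image under \<open>x\<close> of the uniform distribution on
  the indices below \<open>n\<close>, so its integrals reduce to finite averages.\<close>

lemma integral_empirical_measure:
  fixes \<phi> :: "'a::topological_space \<Rightarrow> real"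
  assumes n: "0 < n" and \<phi>: "\<phi> \<in> borel_measurable borel"
  shows "(\<integral>y. \<phi> y \<partial>empirical_measure x n) = (\<Sum>i<n. \<phi> (x i)) / real n"
proof -
  let ?p = "pmf_of_set {..<n}"
  have ne: "{..<n} \<noteq> {}"
    using n by auto
  have "empirical_measure x n = distr (measure_pmf ?p) borel x"
  proof (rule measure_eqI)
    fix A
    assume "A \<in> sets (empirical_measure x n)"
    then have A: "A \<in> sets borel"
      by simp
    have "(\<Sum>i<n. indicator A (x i)) = (of_nat (card ({..<n} \<inter> x -` A)) :: ennreal)"
      by (simp add: sum.inter_restrict[symmetric] indicator_def of_bool_def sum.If_cases
        Int_def vimage_def)
    then show "emeasure (empirical_measure x n) A = emeasure (distr (measure_pmf ?p) borel x) A"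
      using A n ne
      by (simp add: emeasure_empirical_measure emeasure_distr emeasure_pmf_of_set
        ennreal_of_nat_eq_real_of_nat ennreal_mult[symmetric])
  qed simp
  then show ?thesis
    using \<phi> ne by (simp add: integral_distr integral_pmf_of_set)
qed

text \<open>If the two values differed, disjoint neighbourhoods would separate them. The
  neighbourhood of the integral against \<open>\<nu>\<close> defines a weak-star open set that
  \<open>s\<close> visits infinitely often, while the integrals eventually stay in the other
  one.\<close>

lemma integral_accumulation_point:
  fixes \<psi> :: "'a::topological_space \<Rightarrow> real"
  assumes acc: "accumulation_point weak_star_topology s \<nu>"
    and \<psi>: "\<psi> \<in> bcontfun" and lim: "(\<lambda>n. \<integral>y. \<psi> y \<partial>s n) \<longlonglongrightarrow> l"
  shows "(\<integral>y. \<psi> y \<partial>\<nu>) = l"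
proof (rule ccontr)
  assume "(\<integral>y. \<psi> y \<partial>\<nu>) \<noteq> l"
  then obtain U V where UV: "open U" "open V" "(\<integral>y. \<psi> y \<partial>\<nu>) \<in> U" "l \<in> V" "U \<inter> V = {}"
    using hausdorff by metis
  let ?U = "{\<mu> \<in> borel_prob_measures. (\<integral>x. \<psi> x \<partial>\<mu>) \<in> U}"
  have "openin weak_star_topology ?U"
    unfolding weak_star_topology_def using \<psi> UV(1)
    by (intro topology_generated_by_Basis) blast
  moreover have "\<nu> \<in> ?U"
    using acc UV(3) by (simp add: accumulation_point_def topspace_weak_star_topology)
  ultimately have "\<exists>\<^sub>F n in sequentially. s n \<in> ?U"
    using acc unfolding accumulation_point_def by blast
  moreover have "\<forall>\<^sub>F n in sequentially. (\<integral>y. \<psi> y \<partial>s n) \<in> V"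
    using lim UV(2,4) by (rule topological_tendstoD)
  ultimately have "\<exists>\<^sub>F n in sequentially. s n \<in> ?U \<and> (\<integral>y. \<psi> y \<partial>s n) \<in> V"
    by (rule frequently_eventually_frequently)
  then show False
    using UV(5) by (auto dest: frequently_ex)
qed

section \<open>Generating sets and continuous approximation of indicators\<close>

text \<open>Compactness gives a finite net at each scale \<open>1 / Suc n\<close>. The balls around
  the net points form a countable base, and closing it under finite intersections makes it stable
  while keeping it countable and open.\<close>

lemma compact_UNIV_countable_Int_stable_generator:
  assumes "compact (UNIV :: 'a::metric_space set)"
  obtains E :: "'a::metric_space set set"
  where "countable E" "Int_stable E" "\<And>U. U \<in> E \<Longrightarrow> open U" "UNIV \<in> E"
    "sets borel = sigma_sets UNIV E"
proof -
  have "\<exists>K. finite K \<and> (UNIV :: 'a set) \<subseteq> (\<Union>x\<in>K. ball x (1 / real (Suc n)))" for n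
    by (rule compactE_image[OF assms, of UNIV "\<lambda>x. ball x (1 / real (Suc n))"])
      (auto simp del: of_nat_Suc intro: centre_in_ball[THEN iffD2])
  then obtain K where K: "\<And>n. finite (K n)"
    "\<And>n. (UNIV :: 'a set) \<subseteq> (\<Union>x\<in>K n. ball x (1 / real (Suc n)))"
    by metis
  define B where "B = (\<Union>n. (\<lambda>x. ball x (1 / real (Suc n))) ` K n)"
  define E where "E = Inter ` {F. finite F \<and> F \<subseteq> B}"
  have "countable B"
    unfolding B_def using K(1) by (intro countable_UN countable_image) (auto intro: countable_finite)
  then have cE: "countable E"
    unfolding E_def by (intro countable_image countable_Collect_finite_subset)
  moreover have "Int_stable E"
  proof (rule Int_stableI)
    fix a b
    assume "a \<in> E" "b \<in> E"
    then obtain F G where "a = \<Inter>F" "b = \<Inter>G" "finite F" "finite G" "F \<subseteq> B" "G \<subseteq> B"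
      unfolding E_def by blast
    then show "a \<inter> b \<in> E"
      unfolding E_def by (intro image_eqI[of _ _ "F \<union> G"]) auto
  qed
  moreover have E_open: "open U" if "U \<in> E" for U
    using that unfolding E_def B_def by (auto intro!: open_Inter)
  \<comment> \<open>The whole space arises as the intersection of the empty family.\<close>
  moreover have "UNIV \<in> E"
    unfolding E_def by (intro image_eqI[of _ _ "{}"]) auto
  moreover have "sets borel = sigma_sets UNIV E"
  proof
    show "sigma_sets UNIV E \<subseteq> sets borel"
      using sets.sigma_sets_subset[of E borel] borel_open[OF E_open] by (simp add: subsetI)
    have "U \<in> sigma_sets UNIV E" if "open U" for U
    proof -
      have "\<exists>V\<in>B. x \<in> V \<and> V \<subseteq> U" if "x \<in> U" for x
      proof -
        obtain e where e: "e > 0" "ball x e \<subseteq> U"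
          using \<open>open U\<close> \<open>x \<in> U\<close> openE by blast
        \<comment> \<open>Half of \<open>e\<close>: a ball of this radius that contains
          \<open>x\<close> has all its points within \<open>e\<close> of \<open>x\<close>.\<close>
        obtain n where n: "1 / real (Suc n) < e / 2"
          using e(1) nat_approx_posE[of "e / 2"] by auto
        obtain c where c: "c \<in> K n" "x \<in> ball c (1 / real (Suc n))"
          using K(2)[of n] by blast
        have "ball c (1 / real (Suc n)) \<subseteq> ball x e"
        proof
          fix z
          assume "z \<in> ball c (1 / real (Suc n))"
          then show "z \<in> ball x e"
            using c(2) n dist_triangle[of x z c] by (simp add: dist_commute)
        qed
        then show ?thesis
          using c e(2) unfolding B_def by blast
      qed
      then have "U = \<Union>{V \<in> B. V \<subseteq> U}"
        by blast
      moreover have "B \<subseteq> E"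
        unfolding E_def by (auto intro: image_eqI[of _ _ "{_}"])
      then have "\<Union>{V \<in> B. V \<subseteq> U} \<in> sigma_sets UNIV E"
        using \<open>countable B\<close>
        by (intro sigma_sets_UNION) (auto intro: countable_subset[of _ B] sigma_sets.Basic)
      ultimately show ?thesis
        by simp
    qed
    then show "sets borel \<subseteq> sigma_sets UNIV E"
      by (auto simp: borel_def intro!: sigma_sets_mono)
  qed
  ultimately show ?thesis
    by (rule that)
qed

text \<open>Continuous minorants of the indicator of \<open>U\<close>, increasing in
  \<open>k\<close>. At a point of an open proper subset the value is 1 as soon as \<open>k\<close>
  reaches the reciprocal of the distance to the complement.\<close>

definition bump :: "'a::metric_space set \<Rightarrow> nat \<Rightarrow> 'a \<Rightarrow> real" where
  "bump U k x = min 1 (real k * infdist x (- U))"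

lemma bump_abs_le: "\<bar>bump U k x\<bar> \<le> 1"
  using infdist_nonneg[of x "- U"] by (simp add: bump_def)

lemma bump_bcontfun: "bump U k \<in> bcontfun"
proof -
  have "continuous_on UNIV (bump U k)"
    unfolding bump_def by (intro continuous_intros)
  moreover have "bounded (range (bump U k))"
    using bump_abs_le[of U k] by (auto simp: bounded_iff)
  ultimately show ?thesis
    by (simp add: bcontfun_def)
qed

lemma bcontfun_borel_measurable:
  fixes f :: "'a::topological_space \<Rightarrow> real"
  assumes "f \<in> bcontfun"
  shows "f \<in> borel_measurable borel"
  using assms by (intro borel_measurable_continuous_onI) (simp add: bcontfun_def)

text \<open>Fails for \<open>U = UNIV\<close>: the distance to the empty set is \<open>0\<close> by convention.\<close>

lemma bump_tendsto_indicator: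
  assumes "open U" "U \<noteq> UNIV"
  shows "(\<lambda>k. bump U k x) \<longlonglongrightarrow> indicator U x"
proof (cases "x \<in> U")
  case True
  then have pos: "infdist x (- U) > 0"
    using assms by (intro infdist_pos_not_in_closed) auto
  obtain N where N: "1 < real N * infdist x (- U)"
    using reals_Archimedean3[OF pos] by blast
  have "\<forall>\<^sub>F k in sequentially. bump U k x = indicator U x"
    using eventually_ge_at_top[of N]
  proof eventually_elim
    fix k
    assume "N \<le> k"
    then have "real N * infdist x (- U) \<le> real k * infdist x (- U)"
      using pos by (intro mult_right_mono) auto
    then show "bump U k x = indicator U x"
      using N True by (simp add: bump_def)
  qed
  then show ?thesis
    by (rule tendsto_eventually)
qed (simp add: bump_def)

text \<open>By dominated convergence with the constant 1, the integrals of the bumps determine a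
  finite Borel measure on every open proper subset.\<close>

lemma integral_bump_tendsto_measure:
  assumes N: "finite_measure N" "sets N = sets borel" and U: "open U" "U \<noteq> UNIV"
  shows "(\<lambda>k. \<integral>x. bump U k x \<partial>N) \<longlonglongrightarrow> measure N U"
proof -
  interpret finite_measure N by fact
  have meas: "f \<in> borel_measurable N" if "f \<in> borel_measurable borel" for f :: "'a \<Rightarrow> real"
    using that N(2) by (simp cong: measurable_cong_sets)
  have "(\<lambda>k. \<integral>x. bump U k x \<partial>N) \<longlonglongrightarrow> (\<integral>x. indicator U x \<partial>N)"
  proof (rule integral_dominated_convergence[where w = "\<lambda>_. 1"])
    show "(indicator U :: 'a \<Rightarrow> real) \<in> borel_measurable N"
      using U(1) by (intro meas) auto
    show "bump U k \<in> borel_measurable N" for k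
      by (intro meas bcontfun_borel_measurable bump_bcontfun)
    show "AE x in N. (\<lambda>k. bump U k x) \<longlonglongrightarrow> indicator U x"
      using bump_tendsto_indicator[OF U] by simp
  qed (auto simp: bump_abs_le)
  then show ?thesis
    using sets_eq_imp_space_eq[OF N(2)] by simp
qed

section \<open>Stationarity of the accumulation points\<close>

text \<open>Stationarity means \<open>\<nu> = \<nu> \<bind> m\<close>. Invariance of the bump
  integrals gives equality of the two measures on each member of \<open>E\<close> in the limit, and
  an intersection-stable generator determines a finite measure.\<close>

lemma stationary_measureI_bump:
  fixes m :: "'a::metric_space \<Rightarrow> 'a measure"
  assumes m: "transition_kernel m" and \<nu>: "\<nu> \<in> borel_prob_measures"
    and E: "Int_stable E" "\<And>U. U \<in> E \<Longrightarrow> open U" "UNIV \<in> E" "sets borel = sigma_sets UNIV E"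
    and inv: "\<And>U k. U \<in> E \<Longrightarrow> (\<integral>x. bump U k x \<partial>\<nu>) = (\<integral>x. \<integral>y. bump U k y \<partial>m x \<partial>\<nu>)"
  shows "stationary_measure m \<nu>"
proof -
  interpret prob_space \<nu>
    using \<nu> by (simp add: borel_prob_measures_def)
  have sets_\<nu>: "sets \<nu> = sets borel"
    using \<nu> by (simp add: borel_prob_measures_def)
  then have space_\<nu>: "space \<nu> = UNIV"
    using sets_eq_imp_space_eq by force
  define \<rho> where "\<rho> = \<nu> \<bind> m"
  have sets_\<rho>: "sets \<rho> = sets borel"
    unfolding \<rho>_def using space_\<nu> transition_kernel_prob_space(2)[OF m]
    by (intro sets_bind) auto
  then have space_\<rho>: "space \<rho> = UNIV"
    using sets_eq_imp_space_eq by force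
  have em_\<rho>: "emeasure \<rho> A = (\<integral>\<^sup>+x. ennreal (measure (m x) A) \<partial>\<nu>)" if "A \<in> sets borel" for A
    unfolding \<rho>_def by (rule emeasure_bind_transition_kernel[OF m sets_\<nu> that])
  have "measure (m x) UNIV = 1" for x
    using prob_space.prob_space[OF transition_kernel_prob_space(1)[OF m, of x]]
      sets_eq_imp_space_eq[OF transition_kernel_prob_space(2)[OF m, of x]] by simp
  then have \<rho>_UNIV: "emeasure \<rho> UNIV = 1"
    using em_\<rho>[of UNIV] emeasure_space_1 by simp
  then have fin_\<rho>: "finite_measure \<rho>"
    by (intro finite_measureI) (simp add: space_\<rho>)
  have "\<nu> = \<rho>"
  proof (rule measure_eqI_generator_eq[where E = E and \<Omega> = UNIV and A = "\<lambda>_. UNIV"])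
    fix U
    assume U: "U \<in> E"
    show "emeasure \<nu> U = emeasure \<rho> U"
    \<comment> \<open>All bumps of \<open>UNIV\<close> are 0 and carry no information, so this case
      compares total masses instead.\<close>
    proof (cases "U = UNIV")
      case True
      then show ?thesis
        using emeasure_space_1 space_\<nu> \<rho>_UNIV by simp
    next
      case False
      have "(\<integral>x. bump U k x \<partial>\<rho>) = (\<integral>x. bump U k x \<partial>\<nu>)" for k
        unfolding inv[OF U] \<rho>_def using bump_bcontfun[of U k]
        by (intro integral_bind_transition_kernel[OF m finite_measure_axioms sets_\<nu>]
            bcontfun_borel_measurable) (auto simp: bcontfun_def)
      then have "measure \<nu> U = measure \<rho> U"
        using integral_bump_tendsto_measure[OF finite_measure_axioms sets_\<nu> E(2)[OF U] False]
          integral_bump_tendsto_measure[OF fin_\<rho> sets_\<rho> E(2)[OF U] False]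
        by (simp add: LIMSEQ_unique)
      then show ?thesis
        by (simp add: emeasure_eq_measure finite_measure.emeasure_eq_measure[OF fin_\<rho>])
    qed
  qed (use E sets_\<nu> sets_\<rho> in auto)
  moreover have "(\<integral>x. measure (m x) A \<partial>\<nu>) = measure \<rho> A" if A: "A \<in> sets borel" for A
  proof -
    have "(\<lambda>x. measure (m x) A) \<in> borel_measurable \<nu>"
      using m A sets_\<nu> by (simp add: transition_kernel_def cong: measurable_cong_sets)
    then have "(\<integral>x. measure (m x) A \<partial>\<nu>) = enn2real (\<integral>\<^sup>+x. ennreal (measure (m x) A) \<partial>\<nu>)"
      by (intro integral_eq_nn_integral) auto
    then show ?thesis
      by (simp only: em_\<rho>[OF A] measure_def[of \<rho>])
  qed
  ultimately show ?thesis
    using \<nu> by (simp add: stationary_measure_def)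
qed

text \<open>A deterministic statement about one trajectory \<open>x\<close>. The Feller property
  enters to make \<open>\<phi> - P \<phi>\<close> an admissible test function for the weak-star
  topology.\<close>

lemma integral_invariant_of_accumulation_point:
  fixes \<phi> :: "'a::topological_space \<Rightarrow> real"
  assumes m: "transition_kernel m" "feller m" and \<phi>: "\<phi> \<in> bcontfun"
    and acc: "accumulation_point weak_star_topology (empirical_measure x) \<nu>"
    and lim: "(\<lambda>n. (\<Sum>k<n. \<phi> (x k) - (\<integral>y. \<phi> y \<partial>m (x k))) / real n) \<longlonglongrightarrow> 0"
  shows "(\<integral>z. \<phi> z \<partial>\<nu>) = (\<integral>z. \<integral>y. \<phi> y \<partial>m z \<partial>\<nu>)"
proof -
  let ?P = "\<lambda>z. \<integral>y. \<phi> y \<partial>m z"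
  have P: "?P \<in> bcontfun"
    using m(2) \<phi> by (simp add: feller_def)
  have d: "(\<lambda>z. \<phi> z - ?P z) \<in> bcontfun"
    using \<phi> P by (auto simp: bcontfun_def intro: continuous_intros bounded_minus_comp)
  have "(\<lambda>n. \<integral>z. \<phi> z - ?P z \<partial>empirical_measure x n) \<longlonglongrightarrow> 0"
  proof (rule Lim_transform_eventually[OF lim])
    show "\<forall>\<^sub>F n in sequentially. (\<Sum>k<n. \<phi> (x k) - ?P (x k)) / real n =
        (\<integral>z. \<phi> z - ?P z \<partial>empirical_measure x n)"
      using eventually_gt_at_top[of 0]
      by eventually_elim (rule integral_empirical_measure[symmetric, OF _ bcontfun_borel_measurable[OF d]])
  qed
  with acc d have "(\<integral>z. \<phi> z - ?P z \<partial>\<nu>) = 0"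
    by (rule integral_accumulation_point)
  moreover have \<nu>: "prob_space \<nu>" "sets \<nu> = sets borel"
    using acc unfolding accumulation_point_def topspace_weak_star_topology
    by (auto simp: borel_prob_measures_def)
  have "integrable \<nu> f" if f: "f \<in> bcontfun" for f :: "'a \<Rightarrow> real"
  proof -
    interpret prob_space \<nu> by (rule \<nu>)
    obtain B where "\<And>x. norm (f x) \<le> B"
      using f by (auto simp: bcontfun_def bounded_iff)
    moreover have "f \<in> borel_measurable \<nu>"
      using bcontfun_borel_measurable[OF f] \<nu>(2) by (simp cong: measurable_cong_sets)
    ultimately show ?thesis
      by (intro integrable_const_bound[where B = B]) auto
  qed
  ultimately show ?thesis
    using \<phi> P by simp
qed

theorem proposition4p2:
  fixes m :: "'a::metric_space \<Rightarrow> 'a measure"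
    and \<Omega> :: "'w measure"
    and \<Phi> :: "nat \<Rightarrow> 'w \<Rightarrow> 'a"
  assumes "compact (UNIV :: 'a set)"
    and "transition_kernel m"
    and "feller m"
    and "markov_chain \<Omega> m \<Phi>"
  shows "AE \<omega> in \<Omega>. \<forall>\<nu>.
    accumulation_point weak_star_topology (empirical_measure (\<lambda>i. \<Phi> i \<omega>)) \<nu> \<longrightarrow>
    stationary_measure m \<nu>"
proof -
  obtain E :: "'a set set" where cE: "countable E"
    and E: "Int_stable E" "\<And>U. U \<in> E \<Longrightarrow> open U" "UNIV \<in> E" "sets borel = sigma_sets UNIV E"
    using compact_UNIV_countable_Int_stable_generator[OF assms(1)] by blast
  have "AE \<omega> in \<Omega>. (\<lambda>n. (\<Sum>i<n. bump U k (\<Phi> i \<omega>) - (\<integral>y. bump U k y \<partial>m (\<Phi> i \<omega>))) / real n)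
      \<longlonglongrightarrow> 0" for U k
    by (rule markov_chain_mean_defect_tendsto_0[OF assms(4,2)
          bcontfun_borel_measurable[OF bump_bcontfun] bump_abs_le])
  \<comment> \<open>Only countably many pairs of \<open>U\<close> and \<open>k\<close> occur, so a
    single null set serves them all. It is fixed before \<open>\<nu>\<close> is chosen, and hence
    works for all accumulation points at once.\<close>
  then have "AE \<omega> in \<Omega>. \<forall>U\<in>E. \<forall>k.
      (\<lambda>n. (\<Sum>i<n. bump U k (\<Phi> i \<omega>) - (\<integral>y. bump U k y \<partial>m (\<Phi> i \<omega>))) / real n) \<longlonglongrightarrow> 0"
    using cE by (simp add: AE_ball_countable AE_all_countable)
  then show ?thesis
  proof eventually_elim
    case (elim \<omega>)
    show ?case
    proof (intro allI impI)
      fix \<nu>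
      assume acc: "accumulation_point weak_star_topology (empirical_measure (\<lambda>i. \<Phi> i \<omega>)) \<nu>"
      then have "\<nu> \<in> borel_prob_measures"
        by (simp add: accumulation_point_def topspace_weak_star_topology)
      then show "stationary_measure m \<nu>"
        using E integral_invariant_of_accumulation_point[OF assms(2,3) bump_bcontfun acc] elim
        by (intro stationary_measureI_bump[OF assms(2), of \<nu> E]) auto
    qed
  qed
qed

end
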